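(* Let $(X,d)$ be a metric space and let $t>0$. Then both set functions on $\mathcal{F}(X)$ given by $$\kappa^t(A) := \exp\{C^t(A)\} - 1 \qquad\text{and}\qquad C^t(A)$$ (where $C^t(A)$ is the complexity of the finite metric space $(A,td)$) are diversities on $X$.
   Context: For a set $X$, $\mathcal{F}(X)$ denotes the collection of all finite subsets of $X$ (including $\emptyset$). A set function $\delta:\mathcal{F}(X)\to\mathbb{R}$ is called a diversity if: (1) $\delta(A)=0$ if and only if the cardinality of $A$ is at most $1$; and (2) $\delta(A\cup B)\le \delta(A\cup C)+\delta(B\cup C)$ for all $A,B,C\in\mathcal{F}(X)$ with $C\neq\emptyset$. Complexity. Let $(A,\rho)$ be a non-empty finite metric space and $Z(x,y)=e^{-\rho(x,y)}$. For a probability measure $p=(p_x)_{x\in A}$ on $A$ put $(Zp)_x=\sum_{y\in A}Z(x,y)p_y$ and, for $\alpha\in[0,\infty]$, $$H^Z_\alpha(p)=\begin{cases}\frac{1}{1-\alpha}\log\left(\sum_x p_x (Zp)_x^{\alpha-1}\right), & \alpha\in[0,1)\cup(1,\infty),\\ -\sum_x p_x\log (Zp)_x, & \alpha=1,\\ -\log\left(\max_{x:\,p_x>0}(Zp)_x\right), & \alpha=\infty.\end{cases}$$ The complexity of $(A,\rho)$ is $\sup_p H^Z_\alpha(p)$, the supremum being over all probability measures $p$ on $A$; by a known theorem of Leinster and Meckes this value does not depend on the choice of $\alpha\in[0,\infty]$. For a metric space $(X,d)$, $t>0$ and a non-empty finite $A\subseteq X$, $C^t(A)$ is the complexity of the metric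 space $(A,td)$; by convention $C^t(\emptyset)=0$. *)

theory Defs
  imports "HOL-Probability.Probability"
begin

definition diversity :: "'a set \<Rightarrow> ('a set \<Rightarrow> real) \<Rightarrow> bool" where
  "diversity X \<delta> \<longleftrightarrow>
     (\<forall>A\<in>Fpow X. \<delta> A = 0 \<longleftrightarrow> card A \<le> 1) \<and>
     (\<forall>A\<in>Fpow X. \<forall>B\<in>Fpow X. \<forall>C\<in>Fpow X.
        C \<noteq> {} \<longrightarrow> \<delta> (A \<union> B) \<le> \<delta> (A \<union> C) + \<delta> (B \<union> C))"

definition similarity :: "('a \<Rightarrow> 'a \<Rightarrow> real) \<Rightarrow> 'a \<Rightarrow> 'a \<Rightarrow> real" where
  "similarity \<rho> x y = exp (- \<rho> x y)"

text \<open>The entry at \<open>x\<close> of the vector \<open>Z p\<close>; probability measures on a finite set \<open>A\<close> are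
  modelled as mass functions \<open>p\<close> with \<open>set_pmf p \<subseteq> A\<close>.\<close>

definition typicality :: "'a set \<Rightarrow> ('a \<Rightarrow> 'a \<Rightarrow> real) \<Rightarrow> 'a pmf \<Rightarrow> 'a \<Rightarrow> real" where
  "typicality A Z p x = (\<Sum>y\<in>A. Z x y * pmf p y)"

text \<open>The order \<open>\<alpha> \<in> [0, \<infinity>]\<close> is an extended nonnegative real. In the uses below all values
  of \<open>typicality\<close> are positive, so that \<open>powr\<close> and \<open>ln\<close> have their usual meaning.\<close>

definition entropy_of_order ::
  "'a set \<Rightarrow> ('a \<Rightarrow> 'a \<Rightarrow> real) \<Rightarrow> ennreal \<Rightarrow> 'a pmf \<Rightarrow> real" where
  "entropy_of_order A Z \<alpha> p =
     (if \<alpha> = 1 then - (\<Sum>x\<in>A. pmf p x * ln (typicality A Z p x))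
      else if \<alpha> = \<infinity> then - ln (Max {typicality A Z p x | x. x \<in> A \<and> pmf p x > 0})
      else 1 / (1 - enn2real \<alpha>) *
             ln (\<Sum>x\<in>A. pmf p x * typicality A Z p x powr (enn2real \<alpha> - 1)))"

text \<open>The order \<open>\<alpha>\<close> is kept as a parameter; by a theorem of Leinster and Meckes the complexity
  does not depend on it. For a finite metric space the entropies lie between 0 and the
  diameter of \<open>A\<close>, so the supremum is a genuine one.\<close>

definition complexity :: "ennreal \<Rightarrow> 'a set \<Rightarrow> ('a \<Rightarrow> 'a \<Rightarrow> real) \<Rightarrow> real" where
  "complexity \<alpha> A \<rho> =
     (SUP p\<in>{p. set_pmf p \<subseteq> A}. entropy_of_order A (similarity \<rho>) \<alpha> p)"

definition scaled_complexity ::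
  "ennreal \<Rightarrow> ('a \<Rightarrow> 'a \<Rightarrow> real) \<Rightarrow> real \<Rightarrow> 'a set \<Rightarrow> real" where
  "scaled_complexity \<alpha> d t A =
     (if A = {} then 0 else complexity \<alpha> A (\<lambda>x y. t * d x y))"

definition kappa :: "ennreal \<Rightarrow> ('a \<Rightarrow> 'a \<Rightarrow> real) \<Rightarrow> real \<Rightarrow> 'a set \<Rightarrow> real" where
  "kappa \<alpha> d t A = exp (scaled_complexity \<alpha> d t A) - 1"

end

theory Submission
  imports Defs
begin

text \<open>Let \<open>p\<close> minimise \<open>p\<^sup>T Z p\<close> over the probability vectors and let \<open>K\<close> be the minimum. At \<open>p\<close> the
  typicality is \<open>K\<close> throughout the support, so every entropy of \<open>p\<close> equals \<open>- ln K\<close>; conversely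
  every entropy is bounded by the one of order 0, which is at most \<open>- ln K\<close>. Hence
  \<open>exp C = 1 / K\<close>, which is also the maximum of \<open>2 \<Sum>w - w\<^sup>T Z w\<close> over all \<open>w \<ge> 0\<close>.
  Split an optimal \<open>w\<close> on \<open>A \<union> B\<close> into parts \<open>a\<close> on \<open>A\<close> and \<open>b\<close> on \<open>B - A\<close>, fix \<open>c \<in> C\<close>, and let \<open>x\<close>
  and \<open>y\<close> be the total similarities of \<open>a\<close> and \<open>b\<close> to \<open>c\<close>. The triangle inequality bounds the cross
  term \<open>a\<^sup>T Z b\<close> below by \<open>x y\<close>, and adding the masses \<open>max 0 (1 - x)\<close> to \<open>a\<close> and \<open>max 0 (1 - y)\<close> to \<open>b\<close>
  at \<open>c\<close> gives the triangle inequality for \<open>exp C - 1\<close>. The one for \<open>C\<close> follows, since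
  \<open>m + n - 1 \<le> m n\<close> for \<open>m, n \<ge> 1\<close>.\<close>

section \<open>Jensen-type bounds for weighted means\<close>

text \<open>Weighted AM-GM for \<open>z\<close> and \<open>1\<close> with weights \<open>s\<close>
  and \<open>1 - s\<close>.\<close>

lemma bernoulli_powr_le:
  fixes z s :: real
  assumes "z > 0" "0 \<le> s" "s \<le> 1"
  shows "z powr s \<le> 1 + s * (z - 1)"
  using Youngs_inequality_0[of s "1 - s" z 1] assms by (simp add: algebra_simps)

lemma bernoulli_powr_ge:
  fixes z s :: real
  assumes "z > 0" "s \<le> 0"
  shows "z powr s \<ge> 1 + s * (z - 1)"
proof -
  have "1 + s * (z - 1) \<le> 1 + s * ln z"
    using assms ln_le_minus_one[of z] by (simp add: mult_left_mono_neg)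
  also have "\<dots> \<le> z powr s"
    using assms exp_ge_add_one_self[of "s * ln z"] by (simp add: powr_def)
  finally show ?thesis .
qed

lemma enn2real_eq_one_iff: "\<alpha> \<noteq> \<infinity> \<Longrightarrow> enn2real \<alpha> = 1 \<longleftrightarrow> \<alpha> = 1"
  by (cases \<alpha>) auto

text \<open>Plain functions instead of mass functions, so that vectors can be perturbed and rescaled
  freely; values off \<open>A\<close> are unconstrained.\<close>

locale prob_weights =
  fixes A :: "'a set" and p :: "'a \<Rightarrow> real"
  assumes finite_support: "finite A"
    and nonneg: "x \<in> A \<Longrightarrow> 0 \<le> p x"
    and sum_one: "sum p A = 1"
begin

lemma exists_pos: obtains x where "x \<in> A" "p x > 0"
  using sum_one nonneg by (metis less_le sum.neutral zero_neq_one)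

lemma mean_pos:
  fixes f :: "'a \<Rightarrow> real"
  assumes "\<And>x. x \<in> A \<Longrightarrow> f x > 0"
  shows "(\<Sum>x\<in>A. p x * f x) > 0"
proof -
  obtain x where "x \<in> A" "p x > 0" by (rule exists_pos)
  then show ?thesis
    using finite_support nonneg assms
    by (intro sum_pos2[of A x]) (simp_all add: less_imp_le)
qed

text \<open>The comparison is asked for on the support only: at order infinity the maximum bounds
  the typicality just there.\<close>

lemma mean_mono:
  fixes f g :: "'a \<Rightarrow> real"
  assumes "\<And>x. x \<in> A \<Longrightarrow> p x > 0 \<Longrightarrow> f x \<le> g x"
  shows "(\<Sum>x\<in>A. p x * f x) \<le> (\<Sum>x\<in>A. p x * g x)"
  using assms nonneg by (intro sum_mono) (metis less_le mult_left_mono mult_zero_left order_refl)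

lemma mean_affine:
  fixes f :: "'a \<Rightarrow> real"
  shows "(\<Sum>x\<in>A. p x * (b + s * f x)) = b + s * (\<Sum>x\<in>A. p x * f x)"
proof -
  have "(\<Sum>x\<in>A. p x * (b + s * f x)) = (\<Sum>x\<in>A. b * p x + s * (p x * f x))"
    by (simp add: algebra_simps)
  also have "\<dots> = b * sum p A + s * (\<Sum>x\<in>A. p x * f x)"
    by (simp add: sum.distrib sum_distrib_left)
  finally show ?thesis by (simp add: sum_one)
qed

text \<open>Since \<open>v x / m\<close> has mean 1, its deviation from 1 averages out. This turns
  the Bernoulli bounds into Jensen's inequality for powers.\<close>

lemma mean_relative:
  fixes v :: "'a \<Rightarrow> real"
  assumes "\<And>x. x \<in> A \<Longrightarrow> v x > 0"
  defines "m \<equiv> \<Sum>x\<in>A. p x * v x"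
  shows "(\<Sum>x\<in>A. p x * (1 + s * (v x / m - 1))) = 1"
proof -
  have m: "m > 0" unfolding m_def by (rule mean_pos) (fact assms(1))
  have "(\<Sum>x\<in>A. p x * (1 + s * (v x / m - 1))) = (\<Sum>x\<in>A. p x * ((1 - s) + (s / m) * v x))"
    by (intro sum.cong) (simp_all add: algebra_simps)
  also have "\<dots> = 1 - s + s / m * m"
    unfolding mean_affine m_def ..
  finally show ?thesis using m by simp
qed

lemma mean_powr_scale:
  fixes v :: "'a \<Rightarrow> real"
  assumes "\<And>x. x \<in> A \<Longrightarrow> v x > 0" "m > 0"
  shows "(\<Sum>x\<in>A. p x * v x powr s) = m powr s * (\<Sum>x\<in>A. p x * (v x / m) powr s)"
  using assms by (simp add: sum_distrib_left powr_divide less_imp_le)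

lemma mean_powr_le:
  fixes v :: "'a \<Rightarrow> real"
  assumes v: "\<And>x. x \<in> A \<Longrightarrow> v x > 0" and s: "0 \<le> s" "s \<le> 1"
  shows "(\<Sum>x\<in>A. p x * v x powr s) \<le> (\<Sum>x\<in>A. p x * v x) powr s"
proof -
  define m where "m = (\<Sum>x\<in>A. p x * v x)"
  have m: "m > 0" unfolding m_def by (rule mean_pos) (fact v)
  have "(\<Sum>x\<in>A. p x * (v x / m) powr s) \<le> (\<Sum>x\<in>A. p x * (1 + s * (v x / m - 1)))"
    using v m s by (intro mean_mono bernoulli_powr_le) simp_all
  also have "\<dots> = 1" using v unfolding m_def by (rule mean_relative)
  finally have "m powr s * (\<Sum>x\<in>A. p x * (v x / m) powr s) \<le> m powr s"
    by (intro mult_left_le) auto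
  then show ?thesis
    using mean_powr_scale[of v m s] v m by (simp add: m_def)
qed

lemma mean_powr_ge:
  fixes v :: "'a \<Rightarrow> real"
  assumes v: "\<And>x. x \<in> A \<Longrightarrow> v x > 0" and s: "s \<le> 0"
  shows "(\<Sum>x\<in>A. p x * v x powr s) \<ge> (\<Sum>x\<in>A. p x * v x) powr s"
proof -
  define m where "m = (\<Sum>x\<in>A. p x * v x)"
  have m: "m > 0" unfolding m_def by (rule mean_pos) (fact v)
  have "1 = (\<Sum>x\<in>A. p x * (1 + s * (v x / m - 1)))"
    using v unfolding m_def by (rule mean_relative[symmetric])
  also have "\<dots> \<le> (\<Sum>x\<in>A. p x * (v x / m) powr s)"
    using v m s by (intro mean_mono bernoulli_powr_ge) simp_all
  finally have "m powr s * 1 \<le> m powr s * (\<Sum>x\<in>A. p x * (v x / m) powr s)"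
    by (intro mult_left_mono) auto
  then show ?thesis
    using mean_powr_scale[of v m s] v m by (simp add: m_def)
qed

text \<open>Jensen's inequality from the tangent to \<open>ln\<close> at the mean
  \<open>m\<close>.\<close>

lemma mean_ln_le:
  fixes v :: "'a \<Rightarrow> real"
  assumes v: "\<And>x. x \<in> A \<Longrightarrow> v x > 0"
  shows "(\<Sum>x\<in>A. p x * ln (v x)) \<le> ln (\<Sum>x\<in>A. p x * v x)"
proof -
  define m where "m = (\<Sum>x\<in>A. p x * v x)"
  have m: "m > 0" unfolding m_def by (rule mean_pos) (fact v)
  have "(\<Sum>x\<in>A. p x * ln (v x)) \<le> (\<Sum>x\<in>A. p x * ((ln m - 1) + 1 / m * v x))"
  proof (rule mean_mono)
    fix x assume "x \<in> A"
    then show "ln (v x) \<le> (ln m - 1) + 1 / m * v x"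
      using v[of x] m ln_le_minus_one[of "v x / m"] by (simp add: ln_div)
  qed
  also have "\<dots> = ln m" unfolding mean_affine m_def[symmetric] using m by simp
  finally show ?thesis by (simp add: m_def)
qed

end

section \<open>Weights as probability mass functions\<close>

lemma prob_weights_pmf:
  assumes "finite A" "set_pmf p \<subseteq> A"
  shows "prob_weights A (pmf p)"
  using assms by unfold_locales (auto simp: sum_pmf_eq_1)

lemma exists_pmf:
  assumes "prob_weights A f"
  obtains p where "set_pmf p \<subseteq> A" "\<And>x. x \<in> A \<Longrightarrow> pmf p x = f x"
proof -
  interpret prob_weights A f by fact
  \<comment> \<open>A mass function has total 1 over the whole type, whereas \<open>f\<close> is
    arbitrary off \<open>A\<close>; hence the cut-off.\<close>
  define g where "g x = (if x \<in> A then f x else 0)" for x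
  have g: "g x \<ge> 0" for x using nonneg by (simp add: g_def)
  have "(\<integral>\<^sup>+x. ennreal (g x) \<partial>count_space UNIV) = (\<Sum>x\<in>A. ennreal (g x))"
    using finite_support by (intro nn_integral_count_space') (auto simp: g_def)
  also have "\<dots> = ennreal (\<Sum>x\<in>A. g x)"
    using g by simp
  also have "(\<Sum>x\<in>A. g x) = 1" using sum_one by (simp add: g_def)
  finally have 1: "(\<integral>\<^sup>+x. ennreal (g x) \<partial>count_space UNIV) = 1" by simp
  have "pmf (embed_pmf g) x = g x" for x
    by (rule pmf_embed_pmf) (use g 1 in auto)
  then show ?thesis
    by (intro that[of "embed_pmf g"]) (auto simp: set_pmf_iff g_def split: if_splits)
qed

section \<open>The bilinear form of a similarity matrix\<close>

text \<open>Bracketed so that for \<open>w = pmf p\<close> the inner sum is literally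
  \<open>typicality A Z p x\<close>.\<close>

definition pairing :: "'a set \<Rightarrow> ('a \<Rightarrow> 'a \<Rightarrow> real) \<Rightarrow> ('a \<Rightarrow> real) \<Rightarrow> ('a \<Rightarrow> real) \<Rightarrow> real" where
  "pairing A Z v w = (\<Sum>x\<in>A. v x * (\<Sum>y\<in>A. Z x y * w y))"

lemma pairing_add_left: "pairing A Z (\<lambda>x. u x + v x) w = pairing A Z u w + pairing A Z v w"
  by (simp add: pairing_def sum.distrib algebra_simps)

lemma pairing_add_right: "pairing A Z u (\<lambda>x. v x + w x) = pairing A Z u v + pairing A Z u w"
  by (simp add: pairing_def sum.distrib algebra_simps)

lemma pairing_scale_left: "pairing A Z (\<lambda>x. s * v x) w = s * pairing A Z v w"
  by (simp add: pairing_def sum_distrib_left mult.assoc)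

lemma pairing_scale_right: "pairing A Z v (\<lambda>x. s * w x) = s * pairing A Z v w"
  by (simp add: pairing_def sum_distrib_left mult_ac)

lemma pairing_delta_left:
  assumes "finite A" "c \<in> A"
  shows "pairing A Z (\<lambda>x. if x = c then 1 else 0) w = (\<Sum>y\<in>A. Z c y * w y)"
  using assms by (simp add: pairing_def if_distrib[of "\<lambda>b. b * _"] cong: if_cong)

lemma pairing_commute:
  assumes "\<And>x y. x \<in> A \<Longrightarrow> y \<in> A \<Longrightarrow> Z x y = Z y x"
  shows "pairing A Z v w = pairing A Z w v"
proof -
  have "pairing A Z v w = (\<Sum>x\<in>A. \<Sum>y\<in>A. v x * Z x y * w y)"
    by (simp add: pairing_def sum_distrib_left mult_ac)
  also have "\<dots> = (\<Sum>y\<in>A. \<Sum>x\<in>A. v x * Z x y * w y)" by (rule sum.swap)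
  also have "\<dots> = pairing A Z w v"
    using assms by (simp add: pairing_def sum_distrib_left mult_ac)
  finally show ?thesis .
qed

lemma pairing_restrict:
  assumes "finite U" "A \<subseteq> U" "\<And>x. x \<in> U - A \<Longrightarrow> v x = 0" "\<And>x. x \<in> U - A \<Longrightarrow> w x = 0"
  shows "pairing U Z v w = pairing A Z v w"
proof -
  have "(\<Sum>y\<in>U. Z x y * w y) = (\<Sum>y\<in>A. Z x y * w y)" for x
    using assms by (intro sum.mono_neutral_right) auto
  then show ?thesis unfolding pairing_def
    using assms by (simp, intro sum.mono_neutral_right) auto
qed

section \<open>Minimal energy and its balance condition\<close>

text \<open>Abstracts \<open>exp (- t * d x y)\<close>; the triangle inequality enters later, as a
  multiplicative hypothesis of \<open>max_diversity_triangle\<close>.\<close>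

locale similarity_space =
  fixes A :: "'a set" and Z :: "'a \<Rightarrow> 'a \<Rightarrow> real"
  assumes finite_A: "finite A" and nonempty: "A \<noteq> {}"
    and Z_commute: "x \<in> A \<Longrightarrow> y \<in> A \<Longrightarrow> Z x y = Z y x"
    and Z_pos: "x \<in> A \<Longrightarrow> y \<in> A \<Longrightarrow> Z x y > 0"
    and Z_diag: "x \<in> A \<Longrightarrow> Z x x = 1"
begin

lemma pairing_sym: "pairing A Z v w = pairing A Z w v"
  by (rule pairing_commute) (rule Z_commute)

lemma pairing_nonneg:
  assumes "\<And>x. x \<in> A \<Longrightarrow> v x \<ge> 0" "\<And>x. x \<in> A \<Longrightarrow> w x \<ge> 0"
  shows "pairing A Z v w \<ge> 0"
  unfolding pairing_def using assms Z_pos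
  by (intro sum_nonneg mult_nonneg_nonneg) (auto simp: less_imp_le)

lemma pairing_delta:
  assumes "c \<in> A" "e \<in> A"
  shows "pairing A Z (\<lambda>x. if x = c then 1 else 0) (\<lambda>x. if x = e then 1 else 0) = Z c e"
  using assms finite_A
  by (simp add: pairing_delta_left if_distrib[of "\<lambda>b. _ * b"] cong: if_cong)

lemma exists_minimizer:
  obtains p where "prob_weights A p"
    "\<And>q. prob_weights A q \<Longrightarrow> pairing A Z p p \<le> pairing A Z q q"
proof -
  \<comment> \<open>Pinning functions to 0 off \<open>A\<close> makes the box compact in the product
    over the whole, possibly infinite, type.\<close>
  define S where "S = (\<Pi>\<^sub>E x\<in>UNIV. if x \<in> A then {0..1} else {0::real})"
  define T where "T = S \<inter> {f. sum f A = 1}"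
  have "compactin (product_topology (\<lambda>_. euclidean) UNIV) S"
    unfolding S_def compactin_PiE by auto
  then have "compact S"
    by (simp add: euclidean_product_topology)
  moreover have "closed {f :: 'a \<Rightarrow> real. sum f A = 1}"
    by (intro closed_Collect_eq continuous_on_sum continuous_on_product_coordinates
        continuous_on_const)
  ultimately have T: "compact T" unfolding T_def by (rule compact_Int_closed)
  \<comment> \<open>The cut-off moves a competitor into \<open>T\<close> and keeps its energy, since
    \<open>pairing\<close> reads values on \<open>A\<close> only.\<close>
  have restr: "(\<lambda>x. if x \<in> A then q x else 0) \<in> T" if "prob_weights A q" for q
  proof -
    interpret prob_weights A q by fact
    have "q x \<le> 1" if "x \<in> A" for x
      using member_le_sum[of x A q] nonneg finite_support sum_one that by auto
    then show ?thesis using nonneg sum_one by (auto simp: T_def S_def PiE_iff)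
  qed
  obtain c where c: "c \<in> A" using nonempty by auto
  have "prob_weights A (\<lambda>x. if x = c then 1 else 0)"
    by unfold_locales (use c finite_A in auto)
  then have "T \<noteq> {}" using restr by blast
  moreover have "continuous_on T (\<lambda>f. pairing A Z f f)"
    unfolding pairing_def
    by (intro continuous_on_sum continuous_on_mult continuous_on_const
        continuous_on_subset[OF continuous_on_product_coordinates] subset_UNIV)
  ultimately have "\<exists>p\<in>T. \<forall>q\<in>T. pairing A Z p p \<le> pairing A Z q q"
    by (rule continuous_attains_inf[OF T])
  then obtain p where p: "p \<in> T" "\<And>q. q \<in> T \<Longrightarrow> pairing A Z p p \<le> pairing A Z q q"
    by blast
  show ?thesis
  proof
    show "prob_weights A p"
    proof
      fix x assume x: "x \<in> A"
      have "p x \<in> (if x \<in> A then {0..1} else {0})"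
        using p(1) unfolding T_def S_def by (blast dest: PiE_mem)
      then show "0 \<le> p x" using x by simp
    qed (use p(1) finite_A in \<open>auto simp: T_def\<close>)
  next
    fix q assume "prob_weights A q"
    from p(2)[OF restr[OF this]] show "pairing A Z p p \<le> pairing A Z q q"
      by (simp add: pairing_def)
  qed
qed

text \<open>First-order condition: moving from the minimiser towards the point mass at
  \<open>x\<close> changes the energy at rate \<open>2 * (u x - K)\<close>, so
  \<open>u \<ge> K\<close> on \<open>A\<close>. As \<open>u\<close> has mean \<open>K\<close>,
  equality holds on the support.\<close>

lemma exists_balanced:
  obtains p K where "prob_weights A p" "K > 0" "pairing A Z p p = K"
    "\<And>q. prob_weights A q \<Longrightarrow> K \<le> pairing A Z q q"
    "\<And>x. x \<in> A \<Longrightarrow> p x > 0 \<Longrightarrow> (\<Sum>y\<in>A. Z x y * p y) = K"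
proof -
  obtain p where p: "prob_weights A p"
    and min: "\<And>q. prob_weights A q \<Longrightarrow> pairing A Z p p \<le> pairing A Z q q"
    using exists_minimizer by blast
  interpret prob_weights A p by fact
  define u where "u x = (\<Sum>y\<in>A. Z x y * p y)" for x
  define K where "K = pairing A Z p p"
  have u: "u x > 0" if "x \<in> A" for x
    using mean_pos[of "Z x"] Z_pos that by (simp add: u_def mult.commute)
  have K_mean: "K = (\<Sum>x\<in>A. p x * u x)" by (simp add: K_def pairing_def u_def)
  then have K: "K > 0" using mean_pos u by simp
  have ge: "K \<le> u x" if x: "x \<in> A" for x
  proof (rule ccontr)
    assume "\<not> K \<le> u x"
    then have lt: "u x < K" by simp
    define \<delta> :: "'a \<Rightarrow> real" where "\<delta> y = (if y = x then 1 else 0)" for y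
    define q where "q e y = (1 - e) * p y + e * \<delta> y" for e y
    have sd: "sum \<delta> A = 1" using x finite_A by (simp add: \<delta>_def)
    have q: "prob_weights A (q e)" if "0 \<le> e" "e \<le> 1" for e
    proof
      show "sum (q e) A = 1"
        by (simp add: q_def sum.distrib sum_distrib_left[symmetric] sd sum_one)
    qed (use that nonneg finite_A in \<open>auto simp: q_def \<delta>_def\<close>)
    have dp: "pairing A Z \<delta> p = u x" and dd: "pairing A Z \<delta> \<delta> = 1"
      unfolding \<delta>_def using x finite_A Z_diag
      by (simp_all add: pairing_delta_left u_def if_distrib[of "\<lambda>b. _ * b"] cong: if_cong)
    have pd: "pairing A Z p \<delta> = u x" using pairing_sym[of p \<delta>] dp by simp
    have Q: "pairing A Z (q e) (q e) = (1 - e)\<^sup>2 * K + 2 * e * (1 - e) * u x + e\<^sup>2" for e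
      unfolding q_def pairing_add_left pairing_add_right pairing_scale_left pairing_scale_right
        dp pd dd K_def by (simp add: power2_eq_square algebra_simps)
    have "K \<le> 1" using min[OF q[of 1]] by (simp add: Q K_def[symmetric])
    \<comment> \<open>Half the gap is a small enough step: the linear gain
      \<open>2 * e * (K - u x)\<close> is \<open>4 * e\<^sup>2\<close>, while the quadratic loss is
      below \<open>2 * e\<^sup>2\<close> because \<open>K \<le> 1\<close> and
      \<open>u x > 0\<close>.\<close>
    define e where "e = (K - u x) / 2"
    have e: "0 < e" "e \<le> 1" using lt u[OF x] \<open>K \<le> 1\<close> by (auto simp: e_def)
    have "K \<le> (1 - e)\<^sup>2 * K + 2 * e * (1 - e) * u x + e\<^sup>2"
      using min[OF q[of e]] e by (simp add: Q K_def[symmetric])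
    then have "e * (2 * K - e * K - 2 * (1 - e) * u x - e) \<le> 0"
      by (simp add: power2_eq_square algebra_simps)
    then have "2 * K - e * K - 2 * (1 - e) * u x - e \<le> 0"
      using e by (simp add: mult_le_0_iff)
    moreover have "2 * K = 4 * e + 2 * u x" by (simp add: e_def field_simps)
    then have "2 * K - e * K - 2 * (1 - e) * u x - e = 3 * e - e * K + 2 * (e * u x)"
      by (simp add: algebra_simps)
    moreover have "e * K \<le> e" using e \<open>K \<le> 1\<close> by simp
    moreover have "e * u x > 0" using e u[OF x] by simp
    ultimately show False using e by linarith
  qed
  have "(\<Sum>x\<in>A. p x * (u x - K)) = 0"
    using mean_affine[of "-K" 1 u] by (simp add: K_mean)
  then have "p x * (u x - K) = 0" if "x \<in> A" for x
    using that ge nonneg finite_A by (subst (asm) sum_nonneg_eq_0_iff) auto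
  then have "u x = K" if "x \<in> A" "p x > 0" for x using that by fastforce
  then show ?thesis
    using that[OF p K] min by (auto simp: K_def u_def)
qed

text \<open>Both sides are homogeneous of degree two, so a vector of positive mass can be
  normalised.\<close>

lemma energy_ge:
  assumes min: "\<And>q. prob_weights A q \<Longrightarrow> K \<le> pairing A Z q q"
    and w: "\<And>x. x \<in> A \<Longrightarrow> w x \<ge> 0"
  shows "K * (sum w A)\<^sup>2 \<le> pairing A Z w w"
proof (cases "sum w A = 0")
  case True
  then show ?thesis using w by (simp add: pairing_nonneg)
next
  case False
  define s where "s = sum w A"
  have s: "s > 0" using False w sum_nonneg[of A w] by (simp add: s_def less_le)
  have "prob_weights A (\<lambda>x. (1 / s) * w x)"
  proof
    show "(\<Sum>x\<in>A. 1 / s * w x) = 1"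
      using s by (simp only: sum_distrib_left[symmetric] s_def[symmetric]) simp
  qed (use s w finite_A in auto)
  from min[OF this] have "K \<le> pairing A Z w w / s\<^sup>2"
    unfolding pairing_scale_left pairing_scale_right by (simp add: power2_eq_square)
  then show ?thesis using s by (simp add: field_simps s_def)
qed

text \<open>The order-zero diversity of \<open>q\<close> is the total mass of \<open>w = q / Zq\<close>, and AM-GM in the form
  \<open>2 / (u x * u y) \<le> 1 / (u x)\<^sup>2 + 1 / (u y)\<^sup>2\<close> shows that the energy of \<open>w\<close>
  is at most its mass.\<close>

lemma mean_inverse_le:
  assumes q: "prob_weights A q" and K: "K > 0"
    and min: "\<And>r. prob_weights A r \<Longrightarrow> K \<le> pairing A Z r r"
  shows "(\<Sum>x\<in>A. q x * (1 / (\<Sum>y\<in>A. Z x y * q y))) \<le> 1 / K"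
proof -
  interpret prob_weights A q by fact
  define u where "u x = (\<Sum>y\<in>A. Z x y * q y)" for x
  define w where "w x = q x * (1 / u x)" for x
  define s where "s = sum w A"
  have u: "u x > 0" if "x \<in> A" for x
    using mean_pos[of "Z x"] Z_pos that by (simp add: u_def mult.commute)
  have s: "s > 0" unfolding s_def w_def by (rule mean_pos) (simp add: u)
  have 1: "K * s\<^sup>2 \<le> pairing A Z w w" unfolding s_def
    by (rule energy_ge) (use min u nonneg in \<open>auto simp: w_def less_imp_le\<close>)
  \<comment> \<open>The squares from AM-GM sum to pairings of \<open>h\<close> with
    \<open>q\<close>, and \<open>h x * u x = w x\<close> collapses these to the mass
    \<open>s\<close>.\<close>
  define h where "h x = q x * (1 / u x)\<^sup>2" for x
  have hq: "pairing A Z h q = s"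
    using u unfolding pairing_def u_def[symmetric] s_def h_def w_def
    by (intro sum.cong) (auto simp: power2_eq_square less_imp_neq[symmetric])
  then have qh: "pairing A Z q h = s" using pairing_sym[of q h] by simp
  have "2 * pairing A Z w w \<le> pairing A Z h q + pairing A Z q h"
    unfolding pairing_def sum_distrib_left sum.distrib[symmetric]
  proof (intro sum_mono)
    fix x y assume xy: "x \<in> A" "y \<in> A"
    have "2 * (w x * (Z x y * w y)) = q x * q y * Z x y * (2 * (1 / u x) * (1 / u y))"
      by (simp add: w_def)
    also have "\<dots> \<le> q x * q y * Z x y * ((1 / u x)\<^sup>2 + (1 / u y)\<^sup>2)"
      using xy nonneg Z_pos by (intro mult_left_mono sum_squares_bound) (simp add: less_imp_le)
    finally show "2 * (w x * (Z x y * w y)) \<le> h x * (Z x y * q y) + q x * (Z x y * h y)"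
      by (simp add: h_def algebra_simps)
  qed
  then have "s * (K * s) \<le> s * 1" using 1 hq qh by (simp add: power2_eq_square mult_ac)
  then have "K * s \<le> 1" using s by (simp only: mult_le_cancel_left_pos)
  then have "s \<le> 1 / K" using K by (simp add: field_simps)
  then show ?thesis by (simp add: s_def w_def u_def)
qed

section \<open>Entropies of all orders and their supremum\<close>

text \<open>Every entropy is the logarithm of a power mean of \<open>1 / u\<close> with exponent
  \<open>1 - \<alpha>\<close>: the geometric mean at order 1, the minimum over the support at
  infinity. All lie below the arithmetic mean \<open>m\<close>, which is order 0.\<close>

lemma entropy_le:
  assumes q: "set_pmf q \<subseteq> A"
  shows "entropy_of_order A Z \<alpha> q \<le> ln (\<Sum>x\<in>A. pmf q x * (1 / typicality A Z q x))"
proof -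
  interpret prob_weights A "pmf q" using finite_A q by (rule prob_weights_pmf)
  define u where "u = typicality A Z q"
  define m where "m = (\<Sum>x\<in>A. pmf q x * (1 / u x))"
  have u: "u x > 0" if "x \<in> A" for x
    using mean_pos[of "Z x"] Z_pos that by (simp add: u_def typicality_def mult.commute)
  then have v: "1 / u x > 0" if "x \<in> A" for x using that by simp
  have m: "m > 0" unfolding m_def by (rule mean_pos) (fact v)
  consider "\<alpha> = 1" | "\<alpha> = \<infinity>" | "\<alpha> \<noteq> 1" "\<alpha> \<noteq> \<infinity>" by blast
  then have "entropy_of_order A Z \<alpha> q \<le> ln m"
  proof cases
    case 1
    have "- (\<Sum>x\<in>A. pmf q x * ln (u x)) = (\<Sum>x\<in>A. pmf q x * ln (1 / u x))"
      unfolding sum_negf[symmetric] using u by (intro sum.cong) (auto simp: ln_div)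
    also have "\<dots> \<le> ln m" unfolding m_def by (rule mean_ln_le) (fact v)
    finally show ?thesis using 1 by (simp add: entropy_of_order_def u_def)
  next
    case 2
    define T where "T = {u x | x. x \<in> A \<and> pmf q x > 0}"
    have T: "finite T" using finite_A by (auto simp: T_def)
    obtain x where x: "x \<in> A" "pmf q x > 0" by (rule exists_pos)
    have le: "u x \<le> Max T" if "x \<in> A" "pmf q x > 0" for x
      using T that by (intro Max_ge) (auto simp: T_def)
    have M: "Max T > 0" using le[OF x] u[OF x(1)] by simp
    have "1 / Max T = (\<Sum>x\<in>A. pmf q x * (1 / Max T))"
      using sum_one by (simp only: sum_distrib_right[symmetric])
    also have "\<dots> \<le> m" unfolding m_def
      using le u M by (intro mean_mono) (simp add: frac_le)
    finally have "ln (1 / Max T) \<le> ln m" using M m by simp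
    then show ?thesis using 2 M by (simp add: entropy_of_order_def u_def[symmetric] T_def ln_div)
  next
    case 3
    define a where "a = enn2real \<alpha>"
    have a: "a \<ge> 0" "a \<noteq> 1" using 3
      by (auto simp: a_def enn2real_eq_one_iff)
    define S where "S = (\<Sum>x\<in>A. pmf q x * (1 / u x) powr (1 - a))"
    have S: "(\<Sum>x\<in>A. pmf q x * u x powr (a - 1)) = S"
      unfolding S_def
    proof (intro sum.cong refl)
      fix x assume "x \<in> A"
      then show "pmf q x * u x powr (a - 1) = pmf q x * (1 / u x) powr (1 - a)"
        using u[of x] powr_minus_divide[of "u x" "1 - a"] by (simp add: powr_divide)
    qed
    have Spos: "S > 0" unfolding S_def using u by (intro mean_pos) (simp add: less_imp_neq[symmetric])
    have "1 / (1 - a) * ln S \<le> ln m"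
    proof (cases "a < 1")
      case True
      have "S \<le> m powr (1 - a)" unfolding S_def m_def
        using v a True by (intro mean_powr_le) auto
      then have "ln S \<le> (1 - a) * ln m" using Spos m by (metis ln_le_cancel_iff ln_powr powr_gt_zero less_irrefl)
      then show ?thesis using True by (simp add: field_simps)
    next
      case False
      \<comment> \<open>Here the exponent is negative and Jensen reverses; division by
        \<open>1 - a < 0\<close> reverses it back.\<close>
      have "S \<ge> m powr (1 - a)" unfolding S_def m_def
        using v a False by (intro mean_powr_ge) auto
      then have "ln S \<ge> (1 - a) * ln m" using Spos m by (metis ln_le_cancel_iff ln_powr powr_gt_zero less_irrefl)
      then show ?thesis using False a by (simp add: field_simps)
    qed
    then show ?thesis using 3 S by (simp add: entropy_of_order_def u_def a_def)
  qed
  then show ?thesis by (simp add: m_def u_def)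
qed

text \<open>Points of weight zero drop out of the sums, so the typicality may be replaced by
  \<open>K\<close> throughout.\<close>

lemma entropy_balanced:
  assumes q: "set_pmf q \<subseteq> A" and K: "K > 0"
    and bal: "\<And>x. x \<in> A \<Longrightarrow> pmf q x > 0 \<Longrightarrow> typicality A Z q x = K"
  shows "entropy_of_order A Z \<alpha> q = - ln K"
proof -
  interpret prob_weights A "pmf q" using finite_A q by (rule prob_weights_pmf)
  have mean: "(\<Sum>x\<in>A. pmf q x * f (typicality A Z q x)) = f K" for f :: "real \<Rightarrow> real"
  proof -
    have "(\<Sum>x\<in>A. pmf q x * f (typicality A Z q x)) = (\<Sum>x\<in>A. pmf q x * f K)"
      using bal by (intro sum.cong refl) (metis mult_zero_left pmf_nonneg less_le)
    then show ?thesis using sum_one by (simp add: sum_distrib_right[symmetric])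
  qed
  obtain x where x: "x \<in> A" "pmf q x > 0" by (rule exists_pos)
  then have T: "{typicality A Z q x | x. x \<in> A \<and> pmf q x > 0} = {K}" using bal by blast
  have "1 / (1 - enn2real \<alpha>) * ln (K powr (enn2real \<alpha> - 1)) = - ln K" if "\<alpha> \<noteq> 1" "\<alpha> \<noteq> \<infinity>"
  proof -
    have "enn2real \<alpha> \<noteq> 1" using that by (auto simp: enn2real_eq_one_iff)
    then show ?thesis using K by (simp add: ln_powr field_simps)
  qed
  then show ?thesis
    unfolding entropy_of_order_def T mean[of ln] mean[of "\<lambda>u. u powr (enn2real \<alpha> - 1)"] by auto
qed

text \<open>The minimiser attains the value by \<open>entropy_balanced\<close>;
  \<open>entropy_le\<close> and \<open>mean_inverse_le\<close> bound all other entropies. As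
  \<open>K\<close> is the minimal energy, the supremum is independent of
  \<open>\<alpha>\<close>.\<close>

lemma SUP_entropy_eq:
  obtains p K where "prob_weights A p" "K > 0" "pairing A Z p p = K"
    "\<And>q. prob_weights A q \<Longrightarrow> K \<le> pairing A Z q q"
    "(SUP q\<in>{q. set_pmf q \<subseteq> A}. entropy_of_order A Z \<alpha> q) = - ln K"
proof -
  obtain p K where p: "prob_weights A p" and K: "K > 0" "pairing A Z p p = K"
    and min: "\<And>q. prob_weights A q \<Longrightarrow> K \<le> pairing A Z q q"
    and bal: "\<And>x. x \<in> A \<Longrightarrow> p x > 0 \<Longrightarrow> (\<Sum>y\<in>A. Z x y * p y) = K"
    using exists_balanced by blast
  obtain P where P: "set_pmf P \<subseteq> A" "\<And>x. x \<in> A \<Longrightarrow> pmf P x = p x"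
    using exists_pmf[OF p] by blast
  have attained: "entropy_of_order A Z \<alpha> P = - ln K"
    using P K bal by (intro entropy_balanced) (auto simp: typicality_def)
  have bound: "entropy_of_order A Z \<alpha> q \<le> - ln K" if q: "set_pmf q \<subseteq> A" for q
  proof -
    interpret prob_weights A "pmf q" using finite_A q by (rule prob_weights_pmf)
    define m where "m = (\<Sum>x\<in>A. pmf q x * (1 / typicality A Z q x))"
    have "typicality A Z q x > 0" if "x \<in> A" for x
      using mean_pos[of "Z x"] Z_pos that by (simp add: typicality_def mult.commute)
    then have "m > 0" unfolding m_def by (intro mean_pos) simp
    have "m \<le> 1 / K" unfolding m_def typicality_def
      by (rule mean_inverse_le) (use K min prob_weights_axioms in auto)
    then have "ln m \<le> ln (1 / K)" using \<open>m > 0\<close> K by (subst ln_le_cancel_iff) auto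
    then show ?thesis using entropy_le[OF q, of \<alpha>] K by (simp add: m_def ln_div)
  qed
  have "(SUP q\<in>{q. set_pmf q \<subseteq> A}. entropy_of_order A Z \<alpha> q) = - ln K"
    using P(1) attained bound
    by (intro cSup_eq_maximum) (auto simp: image_iff intro!: exI[of _ P])
  then show ?thesis using that p K min by blast
qed

end

section \<open>Maximum diversity as a quadratic maximum\<close>

text \<open>For empty \<open>A\<close> no mass function qualifies and this is a supremum over the
  empty set; \<open>kappa_eq\<close> therefore treats that case apart.\<close>

definition max_diversity :: "ennreal \<Rightarrow> 'a set \<Rightarrow> ('a \<Rightarrow> 'a \<Rightarrow> real) \<Rightarrow> real" where
  "max_diversity \<alpha> A Z = exp (SUP q\<in>{q. set_pmf q \<subseteq> A}. entropy_of_order A Z \<alpha> q)"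

context similarity_space
begin

text \<open>A vector of mass \<open>s\<close> has energy at least \<open>K * s\<^sup>2\<close>, and
  \<open>2 * s - K * s\<^sup>2\<close> peaks at \<open>s = 1 / K\<close> with value
  \<open>1 / K\<close>.\<close>

lemma max_diversity_ge:
  assumes w: "\<And>x. x \<in> A \<Longrightarrow> w x \<ge> 0"
  shows "2 * sum w A - pairing A Z w w \<le> max_diversity \<alpha> A Z"
proof -
  obtain K where K: "K > 0" and min: "\<And>q. prob_weights A q \<Longrightarrow> K \<le> pairing A Z q q"
    and eq: "(SUP q\<in>{q. set_pmf q \<subseteq> A}. entropy_of_order A Z \<alpha> q) = - ln K"
    using SUP_entropy_eq by blast
  have "K * (sum w A)\<^sup>2 \<le> pairing A Z w w"
    by (rule energy_ge) (use w min in auto)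
  moreover have "2 * sum w A - K * (sum w A)\<^sup>2 \<le> 1 / K"
    using K zero_le_power2[of "K * sum w A - 1"]
    by (simp add: field_simps power2_eq_square)
  moreover have "max_diversity \<alpha> A Z = 1 / K"
    using K by (simp add: max_diversity_def eq exp_minus divide_inverse)
  ultimately show ?thesis by linarith
qed

text \<open>Scaling the minimiser by \<open>1 / K\<close> makes mass and energy both
  \<open>1 / K\<close>, so \<open>max_diversity_ge\<close> is sharp.\<close>

lemma max_diversity_attained:
  obtains w where "\<And>x. x \<in> A \<Longrightarrow> w x \<ge> 0" "sum w A = max_diversity \<alpha> A Z"
    "pairing A Z w w = max_diversity \<alpha> A Z"
proof -
  obtain p K where p: "prob_weights A p" and K: "K > 0" "pairing A Z p p = K"
    and eq: "(SUP q\<in>{q. set_pmf q \<subseteq> A}. entropy_of_order A Z \<alpha> q) = - ln K"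
    using SUP_entropy_eq by blast
  interpret prob_weights A p by fact
  have "max_diversity \<alpha> A Z = 1 / K"
    using K by (simp add: max_diversity_def eq exp_minus divide_inverse)
  then show ?thesis
  proof (intro that[of "\<lambda>x. (1 / K) * p x"])
    show "pairing A Z (\<lambda>x. 1 / K * p x) (\<lambda>x. 1 / K * p x) = max_diversity \<alpha> A Z"
      if "max_diversity \<alpha> A Z = 1 / K"
      unfolding pairing_scale_left pairing_scale_right using that K by simp
  qed (use K nonneg sum_one in \<open>simp_all add: sum_divide_distrib[symmetric]\<close>)
qed

lemma max_diversity_ge_one: "1 \<le> max_diversity \<alpha> A Z"
proof -
  obtain c where c: "c \<in> A" using nonempty by auto
  then show ?thesis
    using max_diversity_ge[of "\<lambda>x. if x = c then 1 else 0" \<alpha>] finite_A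
    by (simp add: pairing_delta Z_diag)
qed

text \<open>On one point the optimal mass \<open>m\<close> satisfies \<open>m = m * m\<close>, and
  \<open>m \<ge> 1\<close> excludes zero.\<close>

lemma max_diversity_singleton:
  assumes "A = {c}"
  shows "max_diversity \<alpha> A Z = 1"
proof -
  obtain w where "sum w A = max_diversity \<alpha> A Z" "pairing A Z w w = max_diversity \<alpha> A Z"
    using max_diversity_attained by blast
  then show ?thesis
    using assms Z_diag[of c] max_diversity_ge_one[of \<alpha>] by (auto simp: pairing_def)
qed

lemma max_diversity_gt_one:
  assumes c: "c \<in> A" and e: "e \<in> A" and "c \<noteq> e" and lt: "Z c e < 1"
  shows "max_diversity \<alpha> A Z > 1"
proof -
  \<comment> \<open>Equal masses \<open>s\<close> at \<open>c\<close> and \<open>e\<close> give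
    \<open>4 * s - 2 * s\<^sup>2 * (1 + Z c e)\<close>; this \<open>s\<close> maximises it, with
    value \<open>2 * s\<close>.\<close>
  define s where "s = 1 / (1 + Z c e)"
  define w :: "'a \<Rightarrow> real"
    where "w x = s * ((if x = c then 1 else 0) + (if x = e then 1 else 0))" for x
  have z: "Z c e > 0" using Z_pos c e by simp
  then have s: "s > 0" "s * (1 + Z c e) = 1" by (simp_all add: s_def)
  have "sum w A = 2 * s"
    unfolding w_def sum_distrib_left[symmetric] sum.distrib using c e finite_A by simp
  moreover have "pairing A Z w w = 2 * s * (s * (1 + Z c e))"
    unfolding w_def pairing_scale_left pairing_scale_right pairing_add_left pairing_add_right
      pairing_delta[OF c c] pairing_delta[OF e e] pairing_delta[OF c e] pairing_delta[OF e c]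
    using Z_commute[OF c e] Z_diag c e by (simp add: algebra_simps)
  ultimately have "2 * s \<le> max_diversity \<alpha> A Z"
    using max_diversity_ge[of w \<alpha>] s by (simp add: w_def)
  moreover have "1 < 2 * s" using z lt by (simp add: s_def field_simps)
  ultimately show ?thesis by simp
qed

text \<open>Lets the test vectors for \<open>A \<union> C\<close> and \<open>B \<union> C\<close>
  live on one common ground set.\<close>

lemma max_diversity_ge_superset:
  assumes U: "finite U" "A \<subseteq> U" and w: "\<And>x. x \<in> A \<Longrightarrow> w x \<ge> 0" "\<And>x. x \<in> U - A \<Longrightarrow> w x = 0"
  shows "2 * sum w U - pairing U Z w w \<le> max_diversity \<alpha> A Z"
proof -
  have "sum w U = sum w A" using U w by (intro sum.mono_neutral_right) auto
  moreover have "pairing U Z w w = pairing A Z w w" using U w by (intro pairing_restrict) auto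
  ultimately show ?thesis using max_diversity_ge[OF w(1)] by simp
qed

lemma similarity_space_subset:
  assumes "S \<subseteq> A" "S \<noteq> {}"
  shows "similarity_space S Z"
proof
  show "finite S" using assms finite_A by (blast intro: finite_subset)
  show "S \<noteq> {}" by fact
  fix x y assume xy: "x \<in> S" "y \<in> S"
  then have "x \<in> A" "y \<in> A" using assms by auto
  then show "Z x y = Z y x" "Z x y > 0" by (auto intro: Z_commute Z_pos)
next
  show "Z x x = 1" if "x \<in> S" for x using that assms Z_diag by auto
qed

end

section \<open>The triangle inequality for maximum diversity\<close>

text \<open>The masses \<open>s\<close> and \<open>r\<close> maximise the two brackets; for \<open>x, y \<le> 1\<close> the difference of the
  two sides is \<open>(1 - x - y)\<^sup>2\<close>.\<close>

lemma added_mass_gain: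
  fixes x y :: real
  assumes "x \<ge> 0" "y \<ge> 0"
  defines "s \<equiv> max 0 (1 - x)" and "r \<equiv> max 0 (1 - y)"
  shows "1 \<le> 2 * x * y + (2 * s * (1 - x) - s\<^sup>2) + (2 * r * (1 - y) - r\<^sup>2)"
proof -
  consider "x \<le> 1" "y \<le> 1" | "x \<le> 1" "y > 1" | "x > 1" "y \<le> 1" | "x > 1" "y > 1" by linarith
  then show ?thesis
  proof cases
    case 1
    then show ?thesis using zero_le_power2[of "1 - x - y"]
      by (simp add: s_def r_def power2_eq_square algebra_simps)
  next
    case 2
    moreover have "x * 1 \<le> x * y" using 2 assms(1) by (intro mult_left_mono) auto
    ultimately have "0 \<le> 2 * (x * y) - 2 * x + x\<^sup>2" using zero_le_power2[of x] by linarith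
    then show ?thesis using 2
      by (simp add: s_def r_def power2_eq_square algebra_simps)
  next
    case 3
    moreover have "1 * y \<le> x * y" using 3 assms(2) by (intro mult_right_mono) auto
    ultimately have "0 \<le> 2 * (x * y) - 2 * y + y\<^sup>2" using zero_le_power2[of y] by linarith
    then show ?thesis using 3
      by (simp add: s_def r_def power2_eq_square algebra_simps)
  next
    case 4
    moreover have "1 * 1 \<le> x * y" using 4 by (intro mult_mono) auto
    ultimately show ?thesis by (simp add: s_def r_def)
  qed
qed

text \<open>The \<open>+ 1\<close> makes this the triangle inequality for
  \<open>max_diversity - 1\<close>, that is, for \<open>kappa\<close>.\<close>

lemma max_diversity_triangle:
  assumes U: "similarity_space (A \<union> B \<union> C) Z"
    and triangle: "\<And>x y z. x \<in> A \<union> B \<union> C \<Longrightarrow> y \<in> A \<union> B \<union> C \<Longrightarrow> z \<in> A \<union> B \<union> C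
                     \<Longrightarrow> Z x y * Z y z \<le> Z x z"
    and ne: "A \<union> B \<noteq> {}" and c: "c \<in> C"
  shows "max_diversity \<alpha> (A \<union> B) Z + 1
           \<le> max_diversity \<alpha> (A \<union> C) Z + max_diversity \<alpha> (B \<union> C) Z"
proof -
  define U where "U = A \<union> B \<union> C"
  interpret similarity_space U Z using U by (simp add: U_def)
  interpret AB: similarity_space "A \<union> B" Z
    using ne by (intro similarity_space_subset) (auto simp: U_def)
  interpret AC: similarity_space "A \<union> C" Z
    using c by (intro similarity_space_subset) (auto simp: U_def)
  interpret BC: similarity_space "B \<union> C" Z
    using c by (intro similarity_space_subset) (auto simp: U_def)
  obtain w where w: "\<And>x. x \<in> A \<union> B \<Longrightarrow> w x \<ge> 0" "sum w (A \<union> B) = max_diversity \<alpha> (A \<union> B) Z"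
    "pairing (A \<union> B) Z w w = max_diversity \<alpha> (A \<union> B) Z"
    using AB.max_diversity_attained by blast
  define a where "a x = (if x \<in> A then w x else 0)" for x
  \<comment> \<open>Removing \<open>A\<close> keeps points of \<open>A \<inter> B\<close> from being
    counted twice.\<close>
  define b where "b x = (if x \<in> B - A then w x else 0)" for x
  define \<delta> :: "'a \<Rightarrow> real" where "\<delta> x = (if x = c then 1 else 0)" for x
  have cU: "c \<in> U" using c by (simp add: U_def)
  have a: "a x \<ge> 0" and b: "b x \<ge> 0" and \<delta>: "\<delta> x \<ge> 0" for x
    using w(1) by (auto simp: a_def b_def \<delta>_def)
  have ab: "a x + b x = w x" if "x \<in> A \<union> B" for x using that by (auto simp: a_def b_def)
  define p where "p = pairing U Z a \<delta>"
  define q where "q = pairing U Z b \<delta>"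
  have \<delta>a: "pairing U Z \<delta> a = p" and \<delta>b: "pairing U Z \<delta> b = q"
    by (simp_all add: p_def q_def pairing_sym)
  have pq: "p \<ge> 0" "q \<ge> 0" using a b \<delta> by (simp_all add: p_def q_def pairing_nonneg)
  have \<delta>\<delta>: "pairing U Z \<delta> \<delta> = 1" unfolding \<delta>_def using cU by (simp add: pairing_delta Z_diag)
  have sum\<delta>: "sum \<delta> U = 1" using cU finite_A by (simp add: \<delta>_def)

  have "sum (\<lambda>x. a x + b x) U = sum (\<lambda>x. a x + b x) (A \<union> B)"
    using finite_A by (intro sum.mono_neutral_right) (auto simp: U_def a_def b_def)
  also have "\<dots> = sum w (A \<union> B)" using ab by (intro sum.cong) auto
  finally have sum_w: "sum a U + sum b U = max_diversity \<alpha> (A \<union> B) Z"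
    by (simp add: w sum.distrib)
  have "pairing U Z (\<lambda>x. a x + b x) (\<lambda>x. a x + b x)
      = pairing (A \<union> B) Z (\<lambda>x. a x + b x) (\<lambda>x. a x + b x)"
    using finite_A by (intro pairing_restrict) (auto simp: U_def a_def b_def)
  also have "\<dots> = pairing (A \<union> B) Z w w"
    unfolding pairing_def using ab by (intro sum.cong arg_cong2[where f="(*)"]) auto
  finally have pairing_w: "pairing U Z a a + 2 * pairing U Z a b + pairing U Z b b
      = max_diversity \<alpha> (A \<union> B) Z"
    by (simp add: w pairing_add_left pairing_add_right pairing_sym[of b a])

  \<comment> \<open>The product factors every pair through \<open>c\<close>, where
    \<open>Z x c * Z c y \<le> Z x y\<close> applies termwise.\<close>
  have "p * q = (\<Sum>x\<in>U. a x * Z x c) * (\<Sum>y\<in>U. Z c y * b y)"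
    unfolding p_def \<delta>b[symmetric]
    using cU finite_A
    by (simp add: pairing_def \<delta>_def if_distrib[of "\<lambda>b. _ * b"] if_distrib[of "\<lambda>b. b * _"] cong: if_cong)
  also have "\<dots> = (\<Sum>x\<in>U. \<Sum>y\<in>U. a x * b y * (Z x c * Z c y))"
    by (simp add: sum_product mult_ac)
  also have "\<dots> \<le> (\<Sum>x\<in>U. \<Sum>y\<in>U. a x * b y * Z x y)"
    using a b cU triangle by (intro sum_mono mult_left_mono) (auto simp: U_def)
  also have "\<dots> = pairing U Z a b" by (simp add: pairing_def sum_distrib_left mult_ac)
  finally have cross: "p * q \<le> pairing U Z a b" .

  define s where "s = max 0 (1 - p)"
  define r where "r = max 0 (1 - q)"
  \<comment> \<open>By bilinearity the added mass contributes exactly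
    \<open>2 * s * (1 - p) - s\<^sup>2\<close>, even if \<open>c\<close> already carries mass of
    \<open>a\<close>.\<close>
  have "2 * sum (\<lambda>x. a x + s * \<delta> x) U - pairing U Z (\<lambda>x. a x + s * \<delta> x) (\<lambda>x. a x + s * \<delta> x)
      \<le> max_diversity \<alpha> (A \<union> C) Z"
    using finite_A a \<delta> c
    by (intro AC.max_diversity_ge_superset) (auto simp: U_def s_def, auto simp: a_def \<delta>_def)
  then have AC: "2 * sum a U - pairing U Z a a + (2 * s * (1 - p) - s\<^sup>2) \<le> max_diversity \<alpha> (A \<union> C) Z"
    by (simp add: sum.distrib sum_distrib_left[symmetric] sum\<delta> pairing_add_left pairing_add_right
        pairing_scale_left pairing_scale_right \<delta>a p_def[symmetric] \<delta>\<delta> power2_eq_square algebra_simps)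
  have "2 * sum (\<lambda>x. b x + r * \<delta> x) U - pairing U Z (\<lambda>x. b x + r * \<delta> x) (\<lambda>x. b x + r * \<delta> x)
      \<le> max_diversity \<alpha> (B \<union> C) Z"
    using finite_A b \<delta> c
    by (intro BC.max_diversity_ge_superset) (auto simp: U_def r_def, auto simp: b_def \<delta>_def)
  then have BC: "2 * sum b U - pairing U Z b b + (2 * r * (1 - q) - r\<^sup>2) \<le> max_diversity \<alpha> (B \<union> C) Z"
    by (simp add: sum.distrib sum_distrib_left[symmetric] sum\<delta> pairing_add_left pairing_add_right
        pairing_scale_left pairing_scale_right \<delta>b q_def[symmetric] \<delta>\<delta> power2_eq_square algebra_simps)
  \<comment> \<open>Without the added masses, the two lower bounds sum to the diversity of
    \<open>A \<union> B\<close> plus \<open>2 * pairing U Z a b\<close>; the cross term and the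
    gains together supply the missing 1.\<close>
  have "1 \<le> 2 * p * q + (2 * s * (1 - p) - s\<^sup>2) + (2 * r * (1 - q) - r\<^sup>2)"
    unfolding s_def r_def by (rule added_mass_gain) (fact pq)+
  then show ?thesis using AC BC cross sum_w pairing_w by linarith
qed

section \<open>Both set functions as diversities\<close>

theorem theorem1p7:
  fixes X :: "'a set" and d :: "'a \<Rightarrow> 'a \<Rightarrow> real" and t :: real and \<alpha> :: ennreal
  assumes "Metric_space X d"
    and "t > 0"
  shows "diversity X (kappa \<alpha> d t) \<and> diversity X (scaled_complexity \<alpha> d t)"
proof -
  interpret Metric_space X d by fact
  define Z where "Z = similarity (\<lambda>x y. t * d x y)"
  have space: "similarity_space A Z" if "A \<in> Fpow X" "A \<noteq> {}" for A
    using that by unfold_locales (auto simp: Fpow_def Z_def similarity_def commute subset_iff)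
  have tri: "Z x y * Z y z \<le> Z x z" if "x \<in> X" "y \<in> X" "z \<in> X" for x y z
  proof -
    have "t * d x z \<le> t * (d x y + d y z)"
      using triangle[OF that] assms(2) by (intro mult_left_mono) auto
    then show ?thesis by (simp add: Z_def similarity_def exp_add[symmetric] algebra_simps)
  qed
  have kappa_eq: "kappa \<alpha> d t A = (if A = {} then 0 else max_diversity \<alpha> A Z - 1)" for A
    by (simp add: kappa_def scaled_complexity_def complexity_def max_diversity_def Z_def)
  \<comment> \<open>This also holds at \<open>{}\<close>, where both functions are 0, so the axioms
    transfer without a case split.\<close>
  have C_eq: "scaled_complexity \<alpha> d t A = ln (1 + kappa \<alpha> d t A)" for A
    by (simp add: kappa_def)
  have nonneg: "kappa \<alpha> d t A \<ge> 0" if "A \<in> Fpow X" for A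
    using similarity_space.max_diversity_ge_one[OF space[OF that]] by (simp add: kappa_eq)
  have zero: "kappa \<alpha> d t A = 0 \<longleftrightarrow> card A \<le> 1" if A: "A \<in> Fpow X" for A
  proof (cases "A = {}")
    case False
    interpret A: similarity_space A Z using A False by (rule space)
    show ?thesis
    proof (cases "\<exists>c. A = {c}")
      case True
      then show ?thesis using A.max_diversity_singleton by (auto simp: kappa_eq)
    next
      case nontrivial: False
      obtain c e where ce: "c \<in> A" "e \<in> A" "c \<noteq> e" using False nontrivial by blast
      then have "d c e > 0" using A by (auto simp: Fpow_def subset_iff)
      then have "Z c e < 1" using assms(2) by (simp add: Z_def similarity_def)
      moreover have "\<not> card A \<le> 1"
        using ce A.finite_A card_le_Suc0_iff_eq[of A] by auto
      ultimately show ?thesis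
        using A.max_diversity_gt_one[OF ce, of \<alpha>] False by (simp add: kappa_eq)
    qed
  qed (simp add: kappa_eq)
  have kappa_triangle: "kappa \<alpha> d t (A \<union> B) \<le> kappa \<alpha> d t (A \<union> C) + kappa \<alpha> d t (B \<union> C)"
    if ABC: "A \<in> Fpow X" "B \<in> Fpow X" "C \<in> Fpow X" "C \<noteq> {}" for A B C
  proof (cases "A \<union> B = {}")
    \<comment> \<open>The left side is the conventional 0 here, and the right side is twice the
      nonnegative \<open>kappa \<alpha> d t C\<close>.\<close>
    case True
    then show ?thesis using nonneg[OF ABC(3)] by (simp add: kappa_eq[of "{}"])
  next
    case False
    obtain c where "c \<in> C" using ABC by blast
    moreover have "similarity_space (A \<union> B \<union> C) Z"
      using ABC by (intro space) (auto simp: Fpow_def)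
    ultimately have "max_diversity \<alpha> (A \<union> B) Z + 1
        \<le> max_diversity \<alpha> (A \<union> C) Z + max_diversity \<alpha> (B \<union> C) Z"
      using False ABC by (intro max_diversity_triangle) (auto simp: Fpow_def intro!: tri)
    then show ?thesis using False ABC(4) by (auto simp: kappa_eq)
  qed
  have C_triangle: "ln (1 + kappa \<alpha> d t (A \<union> B))
      \<le> ln (1 + kappa \<alpha> d t (A \<union> C)) + ln (1 + kappa \<alpha> d t (B \<union> C))"
    if ABC: "A \<in> Fpow X" "B \<in> Fpow X" "C \<in> Fpow X" "C \<noteq> {}" for A B C
  proof -
    have F: "A \<union> B \<in> Fpow X" "A \<union> C \<in> Fpow X" "B \<union> C \<in> Fpow X"
      using ABC by (auto simp: Fpow_def)
    note n = nonneg[OF F(1)] nonneg[OF F(2)] nonneg[OF F(3)]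
    have "1 + kappa \<alpha> d t (A \<union> B) \<le> (1 + kappa \<alpha> d t (A \<union> C)) * (1 + kappa \<alpha> d t (B \<union> C))"
      using kappa_triangle[OF ABC] mult_nonneg_nonneg[OF n(2,3)] by (simp add: algebra_simps)
    then have "ln (1 + kappa \<alpha> d t (A \<union> B))
        \<le> ln ((1 + kappa \<alpha> d t (A \<union> C)) * (1 + kappa \<alpha> d t (B \<union> C)))"
      using n by (subst ln_le_cancel_iff) (auto intro!: mult_pos_pos)
    also have "\<dots> = ln (1 + kappa \<alpha> d t (A \<union> C)) + ln (1 + kappa \<alpha> d t (B \<union> C))"
      using n by (intro ln_mult_pos) auto
    finally show ?thesis .
  qed
  have "ln (1 + kappa \<alpha> d t A) = 0 \<longleftrightarrow> card A \<le> 1" if "A \<in> Fpow X" for A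
    using nonneg[OF that] zero[OF that] by simp
  then show ?thesis
    unfolding diversity_def C_eq using zero kappa_triangle C_triangle by blast
qed

end
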